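(* Consider the Game of Cards with $p$ players and $n=kp+q$ cards ($0\le q<p$), and let $O$ be a configuration. Then the partial order $GC(O)$ is a lattice. Moreover, let $a,b$ be two elements of $GC(O)$ different from $\bot$, let $m\in\mathbb Z^p$ be given by $m_i=\max(s_i(O,a),s_i(O,b))$, and let $c$ be the configuration $c_i=O_i-m_i+m_{i-1}$ (indices modulo $p$). Then $c$ is reachable from $O$ by a sequence of moves with shot vector $m$; if $c$ is non-dual then the greatest lower bound of $a$ and $b$ in $GC(O)$ is $c$, and otherwise it is $\bot$.
   Context: Game of Cards: $p$ players sit in a cycle; indices are taken modulo $p$ (player $p$'s right neighbor is player $1$). A configuration is a vector $(a_1,\dots,a_p)$ of nonnegative integers with sum $n$. A move at position $i$ is allowed in $a$ iff $a_i>a_{i+1}$ (with $a_{p+1}=a_1$); it replaces $a_i$ by $a_i-1$ and $a_{i+1}$ by $a_{i+1}+1$. Let $\mathcal G$ be the directed graph on configurations with an arc $a\to b$ whenever $b$ is obtained from $a$ by one move; a configuration is dual if it lies on a directed cycle of positive length in $\mathcal G$, non-dual otherwise. The shot vector of a sequence of moves is the vector whose $i$-th entry is the number of moves at position $i$; for a non-dual configuration $a$ reachable from $O$, $s(O,a)$ is the shot vector of any sequence of moves from $O$ to $a$ (it is independent of the sequence). $GC(O)$ is the set of all non-dual configurations reachable from $O$, together with an extra element $\bot$ when $q>0$, ordered as follows: for non-dual $a,b$, $b\le a$ iff $b$ is reachable from $a$; and $\bot$ is below every element. *)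

theory Defs
  imports "HOL-Algebra.Lattice"
begin

text \<open>Vectors of length \<open>p\<close> are integer lists with positions \<open>0, \<dots>, p - 1\<close> taken cyclically.
  Integer rather than natural entries keep subtraction of shot vectors exact; non-negativity
  is part of being a configuration.\<close>

definition configuration :: "nat \<Rightarrow> nat \<Rightarrow> int list \<Rightarrow> bool" where
  "configuration p n a \<longleftrightarrow> length a = p \<and> (\<forall>x\<in>set a. 0 \<le> x) \<and> sum_list a = int n"

definition right :: "nat \<Rightarrow> nat \<Rightarrow> nat" where
  "right p i = (i + 1) mod p"

definition left :: "nat \<Rightarrow> nat \<Rightarrow> nat" where
  "left p i = (i + p - 1) mod p"

definition allowed :: "nat \<Rightarrow> int list \<Rightarrow> nat \<Rightarrow> bool" where
  "allowed p a i \<longleftrightarrow> i < p \<and> a ! i > a ! right p i"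

definition move :: "nat \<Rightarrow> int list \<Rightarrow> nat \<Rightarrow> int list" where
  "move p a i = a[i := a ! i - 1, right p i := a ! right p i + 1]"

definition game_graph :: "nat \<Rightarrow> nat \<Rightarrow> (int list \<times> int list) set" where
  "game_graph p n = {(a, b). configuration p n a \<and> configuration p n b \<and>
     (\<exists>i. allowed p a i \<and> b = move p a i)}"

definition reachable :: "nat \<Rightarrow> nat \<Rightarrow> int list \<Rightarrow> int list \<Rightarrow> bool" where
  "reachable p n a b \<longleftrightarrow> (a, b) \<in> (game_graph p n)\<^sup>*"

definition dual :: "nat \<Rightarrow> nat \<Rightarrow> int list \<Rightarrow> bool" where
  "dual p n a \<longleftrightarrow> (a, a) \<in> (game_graph p n)\<^sup>+"

inductive move_seq :: "nat \<Rightarrow> int list \<Rightarrow> nat list \<Rightarrow> int list \<Rightarrow> bool" for p where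
  Nil: "move_seq p a [] a"
| Cons: "allowed p a i \<Longrightarrow> move_seq p (move p a i) is b \<Longrightarrow> move_seq p a (i # is) b"

definition shot_vector :: "nat \<Rightarrow> nat list \<Rightarrow> int list" where
  "shot_vector p is = map (\<lambda>i. int (count_list is i)) [0..<p]"

text \<open>The shot vector \<open>s(a, b)\<close> is a definite description: it is only meaningful when all move
  sequences from \<open>a\<close> to \<open>b\<close> share one shot vector, as they do for non-dual reachable \<open>b\<close>.\<close>

definition shot :: "nat \<Rightarrow> int list \<Rightarrow> int list \<Rightarrow> int list" where
  "shot p a b = (THE s. \<exists>is. move_seq p a is b \<and> s = shot_vector p is)"

datatype gc_elem = Bot | Conf "int list"

fun gc_le :: "nat \<Rightarrow> nat \<Rightarrow> gc_elem \<Rightarrow> gc_elem \<Rightarrow> bool" where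
  "gc_le p n Bot y = True"
| "gc_le p n (Conf b) Bot = False"
| "gc_le p n (Conf b) (Conf a) = reachable p n a b"

text \<open>For \<open>n = k p + q\<close> with \<open>0 \<le> q < p\<close>, the condition \<open>q > 0\<close> reads \<open>n mod p > 0\<close>.\<close>

definition GC :: "nat \<Rightarrow> nat \<Rightarrow> int list \<Rightarrow> gc_elem gorder" where
  "GC p n a\<^sub>0 = \<lparr>carrier = {Conf a | a. reachable p n a\<^sub>0 a \<and> \<not> dual p n a} \<union>
                         (if n mod p > 0 then {Bot} else {}),
               eq = (=), le = gc_le p n\<rparr>"

end

theory Submission
  imports Defs
begin

text \<open>Firing a position never disables another position, so the game behaves like chip-firing: if
  two move sequences start in the same configuration, the first can be continued by those moves of
  the second that exceed it, and the pointwise maximum of two legal shot vectors is again legal.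
  Since a shot vector is determined by its endpoints up to an additive constant, a non-dual
  configuration has a unique shot vector, and reachability becomes the pointwise order on shot
  vectors; meets are then pointwise maxima, unless the maximum leads into a dual configuration,
  from which only dual ones are reachable. When \<open>p\<close> divides the number of cards there are no dual
  configurations, because any vector of shots leading to the constant configuration bounds all
  legal ones. Joins exist because the order is finite with a greatest element.\<close>

section \<open>Vectors of shots as a linear action on card vectors\<close>

definition fire :: "nat \<Rightarrow> int list \<Rightarrow> (nat \<Rightarrow> int) \<Rightarrow> int list" where
  "fire p a v = map (\<lambda>i. a ! i - v i + v (left p i)) [0..<p]"

abbreviation shots :: "nat list \<Rightarrow> nat \<Rightarrow> int" where
  "shots w i \<equiv> int (count_list w i)"

lemma left_less: "i < p \<Longrightarrow> left p i < p"
  by (simp add: left_def)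

lemma right_less: "i < p \<Longrightarrow> right p i < p"
  by (simp add: right_def)

lemma left_right: "i < p \<Longrightarrow> left p (right p i) = i"
  by (cases "i + 1 = p") (auto simp: left_def right_def)

lemma left_0: "0 < p \<Longrightarrow> left p 0 = p - 1"
  by (simp add: left_def)

lemma left_Suc: "Suc i < p \<Longrightarrow> left p (Suc i) = i"
  by (simp add: left_def)

lemma left_eq_iff:
  assumes "i < p" "j < p"
  shows "left p j = i \<longleftrightarrow> j = right p i"
proof
  assume "left p j = i"
  moreover have "right p (left p j) = j"
    using assms(2) by (cases j) (auto simp: left_def right_def)
  ultimately show "j = right p i" by simp
qed (simp add: left_right assms)

lemma length_fire [simp]: "length (fire p a v) = p"
  by (simp add: fire_def)

lemma fire_nth: "i < p \<Longrightarrow> fire p a v ! i = a ! i - v i + v (left p i)"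
  by (simp add: fire_def)

lemma fire_zero: "length a = p \<Longrightarrow> fire p a (\<lambda>i. 0) = a"
  by (rule nth_equalityI) (auto simp: fire_nth)

lemma fire_fire: "fire p (fire p a u) v = fire p a (\<lambda>i. u i + v i)"
  by (rule nth_equalityI) (auto simp: fire_nth left_less)

text \<open>The kernel of the linear part of \<open>fire\<close> consists of the constant vectors:
  equality of the entries at \<open>i\<close> forces the difference \<open>u - v\<close> to agree at
  \<open>i\<close> and at its left neighbor, and this propagates around the cycle.\<close>

lemma fire_eq_imp_const:
  assumes "fire p a u = fire p a v"
  shows "\<exists>t. \<forall>i<p. u i = v i + t"
proof -
  have step: "u i - v i = u (left p i) - v (left p i)" if "i < p" for i
    using arg_cong [OF assms, of "\<lambda>xs. xs ! i"] that by (simp add: fire_nth)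
  have "u i - v i = u 0 - v 0" if "i < p" for i
    using that
  proof (induction i)
    case (Suc i)
    then show ?case using step [of "Suc i"] by (simp add: left_Suc)
  qed simp
  then show ?thesis by (metis add.commute diff_add_cancel)
qed

lemma allowed_neq: "allowed p a i \<Longrightarrow> right p i \<noteq> i"
  by (auto simp: allowed_def)

lemma move_eq_fire:
  assumes "length a = p" "allowed p a i"
  shows "move p a i = fire p a (\<lambda>j. if j = i then 1 else 0)"
proof (rule nth_equalityI)
  fix j assume "j < length (move p a i)"
  then have "j < p" using assms by (simp add: move_def)
  moreover have "i < p" using assms(2) by (simp add: allowed_def)
  ultimately show "move p a i ! j = fire p a (\<lambda>j. if j = i then 1 else 0) ! j"
    using assms allowed_neq [OF assms(2)] left_eq_iff [of i p j]
    by (auto simp: move_def fire_nth nth_list_update right_less)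
qed (use assms in \<open>simp add: move_def\<close>)

section \<open>Move sequences and their shot vectors\<close>

lemma move_seq_fire:
  assumes "move_seq p a w b" "length a = p"
  shows "b = fire p a (shots w)"
  using assms
proof (induction rule: move_seq.induct)
  case (Nil a)
  then show ?case by (simp add: fire_zero)
next
  case (Cons a i w b)
  have "(\<lambda>j. (if j = i then 1 else 0) + shots w j) = shots (i # w)" by auto
  then show ?case using Cons by (simp add: move_eq_fire fire_fire)
qed

lemma move_seq_append: "move_seq p a u b \<Longrightarrow> move_seq p b w c \<Longrightarrow> move_seq p a (u @ w) c"
  by (induction rule: move_seq.induct) (auto intro: move_seq.intros)

inductive_cases move_seq_NilE: "move_seq p a [] b"

inductive_cases move_seq_ConsE: "move_seq p a (i # w) b"

text \<open>\<open>move_seq\<close> grows at the front, whereas the inductions on initial segments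
  of a game below remove the last move.\<close>

lemma move_seq_snocE:
  assumes "move_seq p a (u @ [i]) c"
  obtains b where "move_seq p a u b" "allowed p b i" "c = move p b i"
proof -
  have "\<exists>b. move_seq p a u b \<and> allowed p b i \<and> c = move p b i"
    using assms
  proof (induction u arbitrary: a)
    case Nil
    then show ?case by (auto elim!: move_seq_NilE move_seq_ConsE intro: move_seq.Nil)
  next
    case (Cons j u)
    then show ?case by (fastforce elim: move_seq_ConsE intro: move_seq.Cons)
  qed
  then show thesis using that by blast
qed

section \<open>The exchange property\<close>

text \<open>Additional shots at positions other than \<open>j\<close> can only add cards at
  \<open>j\<close>, coming from its left neighbor, and remove cards from its right neighbor, so the
  descent at \<open>j\<close> does not shrink.\<close>

lemma allowed_fire_mono:
  assumes "allowed p (fire p a u) j" "\<And>i. u i \<le> v i" "u j = v j"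
  shows "allowed p (fire p a v) j"
proof -
  have j: "j < p" using assms(1) by (simp add: allowed_def)
  show ?thesis
    using assms(1,3) assms(2) [of "left p j"] assms(2) [of "right p j"] j
    by (simp add: allowed_def fire_nth left_right right_less)
qed

text \<open>The sequence \<open>w\<close> is replayed after \<open>u\<close>, skipping each move
  that \<open>u\<close> has already paid for. The truncated subtraction on naturals expresses
  exactly this: \<open>v\<close> contains only the excess of \<open>w\<close> over
  \<open>u\<close>.\<close>

lemma move_seq_join:
  assumes "length a = p" "move_seq p a u b" "move_seq p a w c"
  shows "\<exists>v. move_seq p b v (fire p a (\<lambda>i. max (shots u i) (shots w i))) \<and>
             (\<forall>i. count_list v i = count_list w i - count_list u i)"
  using assms(3)
proof (induction w arbitrary: c rule: rev_induct)
  case Nil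
  have "(\<lambda>i. max (shots u i) (shots [] i)) = shots u" by auto
  then show ?case
    using move_seq_fire [OF assms(2,1)] by (intro exI [of _ "[]"]) (simp add: move_seq.Nil)
next
  case (snoc j w)
  obtain d where d: "move_seq p a w d" "allowed p d j" "c = move p d j"
    using snoc.prems by (rule move_seq_snocE)
  define e where "e = fire p a (\<lambda>i. max (shots u i) (shots w i))"
  obtain v where v: "move_seq p b v e" "\<And>i. count_list v i = count_list w i - count_list u i"
    using snoc.IH [OF d(1)] e_def by blast
  have dw: "d = fire p a (shots w)" using move_seq_fire d assms by blast
  show ?case
  proof (cases "count_list w j < count_list u j")
    case True
    \<comment> \<open>The final shot at \<open>j\<close> is still covered by \<open>u\<close>, so
      the maximum does not change and \<open>v\<close> is kept.\<close>
    then have "(\<lambda>i. max (shots u i) (shots w i)) = (\<lambda>i. max (shots u i) (shots (w @ [j]) i))"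
      by (intro ext) auto
    then show ?thesis using v True unfolding e_def by (intro exI [of _ v]) auto
  next
    case False
    \<comment> \<open>Here \<open>w\<close> has caught up with \<open>u\<close> at \<open>j\<close>,
      so the maximum agrees with \<open>w\<close> there and dominates it elsewhere; the legality of
      \<open>j\<close> carries over from \<open>d\<close> to \<open>e\<close>.\<close>
    have al: "allowed p e j"
      unfolding e_def by (rule allowed_fire_mono [OF d(2) [unfolded dw]]) (use False in auto)
    have "(\<lambda>i. max (shots u i) (shots w i) + (if i = j then 1 else 0))
        = (\<lambda>i. max (shots u i) (shots (w @ [j]) i))"
      using False by (intro ext) auto
    then have "move p e j = fire p a (\<lambda>i. max (shots u i) (shots (w @ [j]) i))"
      using move_eq_fire [OF _ al] unfolding e_def by (simp add: fire_fire)
    then have "move_seq p b (v @ [j]) (fire p a (\<lambda>i. max (shots u i) (shots (w @ [j]) i)))"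
      using v(1) al by (metis move_seq.intros move_seq_append)
    then show ?thesis using v(2) False by (intro exI [of _ "v @ [j]"]) auto
  qed
qed

lemma move_seq_le:
  assumes "length a = p" "move_seq p a u b" "move_seq p a w c"
    and "\<And>i. count_list u i \<le> count_list w i"
  shows "\<exists>v. move_seq p b v c \<and> (\<forall>i. count_list v i = count_list w i - count_list u i)"
proof -
  have "(\<lambda>i. max (shots u i) (shots w i)) = shots w" using assms(4) by auto
  then show ?thesis
    using move_seq_join [OF assms(1-3)] move_seq_fire [OF assms(3,1)] by simp
qed

lemma move_seq_positions: "move_seq p a w b \<Longrightarrow> set w \<subseteq> {..<p}"
  by (induction rule: move_seq.induct) (auto simp: allowed_def)

lemma count_list_out: "move_seq p a w b \<Longrightarrow> \<not> i < p \<Longrightarrow> count_list w i = 0"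
  using move_seq_positions by (fastforce simp: count_list_0_iff)

subsection \<open>Reachability and duality\<close>

lemma sum_list_fire:
  assumes "length a = p"
  shows "sum_list (fire p a v) = sum_list a"
proof (cases p)
  case (Suc m)
  \<comment> \<open>The cyclic shift only permutes the summands: the one at 0 becomes the last, and
    all others move down by one.\<close>
  have "(\<Sum>i<p. v (left p i)) = (\<Sum>i<p. v i)"
    using sum.lessThan_Suc_shift [of "\<lambda>i. v (left p i)" m] left_0 [of p] left_Suc [of _ p] Suc
    by simp
  then have "(\<Sum>i<p. a ! i - v i + v (left p i)) = (\<Sum>i<p. a ! i)"
    by (simp add: sum.distrib sum_subtractf)
  then show ?thesis
    using assms by (simp add: sum_list_sum_nth fire_nth atLeast0LessThan)
qed (use assms in \<open>simp add: fire_def\<close>)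

lemma configuration_move:
  assumes "configuration p n a" "allowed p a i"
  shows "configuration p n (move p a i)"
proof -
  have len: "length a = p" and nonneg: "\<And>j. j < p \<Longrightarrow> 0 \<le> a ! j"
    using assms(1) by (auto simp: configuration_def)
  have i: "i < p" "a ! right p i < a ! i" using assms(2) by (auto simp: allowed_def)
  have "0 \<le> move p a i ! j" if "j < p" for j
    using that i nonneg [of j] nonneg [of "right p i"] len right_less [of i p]
    by (auto simp: move_def nth_list_update)
  moreover have "length (move p a i) = p" using len by (simp add: move_def)
  moreover have "sum_list (move p a i) = int n"
    using assms(1) move_eq_fire [OF len assms(2)] sum_list_fire [OF len]
    by (simp add: configuration_def)
  ultimately show ?thesis by (auto simp: configuration_def in_set_conv_nth)
qed

lemma move_seq_configuration:
  "move_seq p a w b \<Longrightarrow> configuration p n a \<Longrightarrow> configuration p n b"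
  by (induction rule: move_seq.induct) (auto intro: configuration_move)

lemma move_seq_reachable:
  "move_seq p a w b \<Longrightarrow> configuration p n a \<Longrightarrow> reachable p n a b"
proof (induction rule: move_seq.induct)
  case (Cons a i w b)
  then have "(a, move p a i) \<in> game_graph p n"
    by (auto simp: game_graph_def configuration_move)
  then show ?case
    using Cons configuration_move unfolding reachable_def
    by (meson converse_rtrancl_into_rtrancl)
qed (simp add: reachable_def)

lemma reachable_move_seq: "reachable p n a b \<Longrightarrow> \<exists>w. move_seq p a w b"
  unfolding reachable_def
proof (induction rule: converse_rtrancl_induct)
  case base
  show ?case using move_seq.Nil by blast
next
  case (step a c)
  then show ?case by (auto simp: game_graph_def intro: move_seq.intros)
qed

lemma reachable_configuration:
  "reachable p n a b \<Longrightarrow> configuration p n a \<Longrightarrow> configuration p n b"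
  using reachable_move_seq move_seq_configuration by blast

text \<open>Turns cycles of the graph into closed move sequences, whose shots can be
  counted.\<close>

lemma dual_iff_cycle:
  assumes "configuration p n a"
  shows "dual p n a \<longleftrightarrow> (\<exists>w. w \<noteq> [] \<and> move_seq p a w a)"
proof
  assume "dual p n a"
  then obtain b where b: "(a, b) \<in> game_graph p n" "reachable p n b a"
    unfolding dual_def reachable_def by (meson tranclD)
  obtain i where "allowed p a i" "b = move p a i" using b(1) by (auto simp: game_graph_def)
  moreover obtain w where "move_seq p b w a" using b(2) reachable_move_seq by blast
  ultimately show "\<exists>w. w \<noteq> [] \<and> move_seq p a w a"
    by (metis list.discI move_seq.Cons)
next
  assume "\<exists>w. w \<noteq> [] \<and> move_seq p a w a"
  then obtain w where "w \<noteq> []" "move_seq p a w a" by blast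
  then obtain i u where "allowed p a i" "move_seq p (move p a i) u a"
    by (cases w) (auto elim: move_seq_ConsE)
  then have "(a, move p a i) \<in> game_graph p n" "reachable p n (move p a i) a"
    using assms configuration_move [of p n a i] move_seq_reachable
    by (auto simp: game_graph_def)
  then show "dual p n a" unfolding dual_def reachable_def by simp
qed

text \<open>A closed sequence acts like the zero vector, so its shot vector is constant; being
  nonempty makes the constant positive.\<close>

lemma cycle_shots:
  assumes "length a = p" "move_seq p a w a" "w \<noteq> []"
  shows "\<exists>t>0. \<forall>i<p. count_list w i = t"
proof -
  have "fire p a (shots w) = fire p a (\<lambda>i. 0)"
    using move_seq_fire [OF assms(2,1)] fire_zero [OF assms(1)] by simp
  from fire_eq_imp_const [OF this] obtain t where t: "\<forall>i<p. shots w i = t" by auto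
  obtain j where "j \<in> set w" using assms(3) by (cases w) auto
  moreover from this have "j < p" using move_seq_positions [OF assms(2)] by auto
  ultimately have "t > 0" using t count_list_0_iff [of w j] by force
  then show ?thesis using t by (intro exI [of _ "nat t"]) auto
qed

text \<open>A cycle through \<open>b\<close> shoots at every position, so it dominates any single
  move \<open>i\<close> from \<open>b\<close> to \<open>c\<close>. The rest of the cycle is then
  playable from \<open>c\<close> and leads back to \<open>b\<close>, and playing \<open>i\<close>
  again closes a cycle at \<open>c\<close>.\<close>

lemma dual_reachable:
  assumes "configuration p n a" "reachable p n a b" "dual p n a"
  shows "dual p n b"
  using assms(2)[unfolded reachable_def] assms(3)
proof (induction rule: rtrancl_induct)
  case (step b c)
  from step.hyps(2) obtain i where cf: "configuration p n b" "configuration p n c"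
    and i: "allowed p b i" "c = move p b i" by (auto simp: game_graph_def)
  have len: "length b = p" using cf by (simp add: configuration_def)
  obtain w where w: "w \<noteq> []" "move_seq p b w b"
    using step dual_iff_cycle [OF cf(1)] by blast
  obtain t where t: "t > 0" "\<forall>j<p. count_list w j = t" using cycle_shots [OF len w(2,1)] by blast
  have i1: "move_seq p b [i] c" using i by (auto intro: move_seq.intros)
  have "count_list [i] j \<le> count_list w j" for j
    using t i(1) by (cases "j = i") (auto simp: allowed_def)
  from move_seq_le [OF len i1 w(2) this] obtain v where "move_seq p c v b" by blast
  then have "move_seq p c (v @ [i]) c" using i1 by (rule move_seq_append)
  then show ?case using dual_iff_cycle [OF cf(2)] by blast
qed

section \<open>Uniqueness of shot vectors of non-dual configurations\<close>

text \<open>Two shot vectors with common endpoints differ by a constant, hence are comparable. The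
  larger sequence then exceeds the smaller one by a closed sequence at \<open>b\<close>, which must
  be empty because \<open>b\<close> is non-dual.\<close>

lemma shots_unique:
  assumes "configuration p n a" "move_seq p a u b" "move_seq p a w b" "\<not> dual p n b"
  shows "count_list u = count_list w"
proof -
  have len: "length a = p" using assms(1) by (simp add: configuration_def)
  have cf: "configuration p n b" using move_seq_configuration assms by blast
  have *: "count_list v i = count_list u i"
    if u: "move_seq p a u b" and v: "move_seq p a v b" and le: "\<And>i. count_list u i \<le> count_list v i"
    for u v i
  proof -
    obtain x where x: "move_seq p b x b" "\<And>i. count_list x i = count_list v i - count_list u i"
      using move_seq_le [OF len u v le] by blast
    have "x = []" using x(1) assms(4) dual_iff_cycle [OF cf] by blast
    then show ?thesis using x(2) [of i] le [of i] by simp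
  qed
  have "fire p a (shots u) = fire p a (shots w)"
    using move_seq_fire [OF _ len] assms(2,3) by metis
  from fire_eq_imp_const [OF this] obtain t where t: "\<forall>i<p. shots u i = shots w i + t" by blast
  show ?thesis
  proof (cases "t \<ge> 0")
    case True
    \<comment> \<open>The constant \<open>t\<close> controls only positions below \<open>p\<close>;
      beyond them the left-hand count is zero.\<close>
    have "count_list w i \<le> count_list u i" for i
    proof (cases "i < p")
      case True
      then show ?thesis using t \<open>t \<ge> 0\<close> by fastforce
    qed (simp add: count_list_out [OF assms(3)])
    then show ?thesis using *[OF assms(3,2)] by blast
  next
    case False
    have "count_list u i \<le> count_list w i" for i
    proof (cases "i < p")
      case True
      then show ?thesis using t \<open>\<not> t \<ge> 0\<close> by fastforce
    qed (simp add: count_list_out [OF assms(2)])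
    then show ?thesis using *[OF assms(2,3)] by (metis ext)
  qed
qed

text \<open>Makes the definite description in \<open>shot\<close> usable: any one sequence reaching
  \<open>b\<close> computes it.\<close>

lemma shot_eq:
  assumes "configuration p n a" "move_seq p a w b" "\<not> dual p n b"
  shows "shot p a b = shot_vector p w"
  unfolding shot_def
proof (rule the_equality)
  show "\<exists>is. move_seq p a is b \<and> shot_vector p w = shot_vector p is" using assms by blast
next
  fix s assume "\<exists>is. move_seq p a is b \<and> s = shot_vector p is"
  then show "s = shot_vector p w"
    using shots_unique [OF assms(1) _ assms(2,3)] by (auto simp: shot_vector_def)
qed

section \<open>Absence of dual configurations when \<open>p\<close> divides \<open>n\<close>\<close>

text \<open>A first move exceeding \<open>v\<close>, at \<open>j\<close> say, would start from shots
  bounded by \<open>v\<close> with equality at \<open>j\<close>. By monotonicity \<open>j\<close>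
  would then be allowed in the constant configuration, which has no allowed move.\<close>

lemma shots_le_constant:
  assumes "length a = p" "move_seq p a w b" "\<And>i. 0 \<le> v i" "\<And>i. i < p \<Longrightarrow> fire p a v ! i = k"
  shows "shots w i \<le> v i"
  using assms(2)
proof (induction w arbitrary: b i rule: rev_induct)
  case Nil
  then show ?case using assms(3) by simp
next
  case (snoc j w)
  obtain d where d: "move_seq p a w d" "allowed p d j"
    using snoc.prems by (rule move_seq_snocE)
  have "shots w j \<noteq> v j"
  proof
    assume "shots w j = v j"
    then have "allowed p (fire p a v) j"
      using allowed_fire_mono [of p a "shots w" j v] snoc.IH [OF d(1)] d move_seq_fire assms(1)
      by metis
    then show False using assms(4) right_less by (auto simp: allowed_def)
  qed
  then show ?case using snoc.IH [OF d(1), of i] by auto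
qed

lemma constant_target:
  assumes "length a = p" "sum_list a = k * int p" "p > 0"
  shows "\<exists>v. (\<forall>i. 0 \<le> v i) \<and> (\<exists>i<p. v i = 0) \<and> (\<forall>i<p. fire p a v ! i = k)"
proof -
  \<comment> \<open>Reaching the constant \<open>k\<close> means that \<open>v\<close> increases by
    \<open>a ! i - k\<close> from \<open>left p i\<close> to \<open>i\<close>, so \<open>v\<close>
    is a partial sum up to a constant. Subtracting the minimum \<mu> makes it non-negative with a
    zero.\<close>
  define h where "h i = (\<Sum>j\<le>i. a ! j - k)" for i
  define \<mu> where "\<mu> = Min (h ` {..<p})"
  define v where "v i = (if i < p then h i - \<mu> else 0)" for i
  have "\<mu> \<in> h ` {..<p}" unfolding \<mu>_def using assms(3) by (intro Min_in) auto
  then have "\<exists>i<p. v i = 0" by (auto simp: v_def)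
  moreover have "0 \<le> v i" for i by (simp add: v_def \<mu>_def)
  moreover have "fire p a v ! i = k" if "i < p" for i
  proof (cases i)
    case 0
    have "{..p - 1} = {..<p}" using assms(3) by auto
    \<comment> \<open>The total surplus over \<open>k\<close> vanishes, which closes the cyclic
      equation at position 0.\<close>
    then have "h (p - 1) = 0"
      using assms by (simp add: h_def sum_subtractf sum_list_sum_nth atLeast0LessThan)
    then show ?thesis using 0 assms(3) by (simp add: fire_nth left_0 v_def h_def)
  next
    case (Suc m)
    then show ?thesis using that by (simp add: fire_nth left_Suc v_def h_def)
  qed
  ultimately show ?thesis by blast
qed

text \<open>If \<open>p\<close> divided \<open>n\<close>, a cycle would shoot at every position,
  while the bound by \<open>constant_target\<close> is zero at some position. This guarantees that
  \<open>Bot\<close> is present whenever a dual configuration is met.\<close>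

lemma dual_not_dvd:
  assumes "p > 0" "configuration p n a" "dual p n a"
  shows "n mod p > 0"
proof (rule ccontr)
  assume "\<not> n mod p > 0"
  then have "n = n div p * p" by auto
  then have len: "length a = p" and "sum_list a = int (n div p) * int p"
    using assms(2) by (auto simp: configuration_def simp flip: of_nat_mult)
  then obtain v where v: "\<And>i. 0 \<le> v i" "\<exists>i<p. v i = 0"
      "\<And>i. i < p \<Longrightarrow> fire p a v ! i = int (n div p)"
    using constant_target assms(1) by blast
  obtain w where w: "w \<noteq> []" "move_seq p a w a"
    using assms(3) dual_iff_cycle [OF assms(2)] by blast
  obtain t where t: "t > 0" "\<forall>i<p. count_list w i = t" using cycle_shots [OF len w(2,1)] by blast
  obtain i where "i < p" "v i = 0" using v(2) by blast
  then show False using shots_le_constant [OF len w(2) v(1,3), of i] t by auto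
qed

lemma finite_configurations: "finite {a. configuration p n a}"
proof (rule finite_subset)
  show "{a. configuration p n a} \<subseteq> {xs. set xs \<subseteq> {0..int n} \<and> length xs = p}"
    using member_le_sum_list by (fastforce simp: configuration_def)
qed (rule finite_lists_length_eq; simp)

subsection \<open>The order\<close>

lemma carrier_Conf:
  "Conf a \<in> carrier (GC p n a\<^sub>0) \<longleftrightarrow> reachable p n a\<^sub>0 a \<and> \<not> dual p n a"
  by (auto simp: GC_def)

lemma carrier_Bot: "Bot \<in> carrier (GC p n a\<^sub>0) \<longleftrightarrow> n mod p > 0"
  by (auto simp: GC_def)

lemma le_GC [simp]: "x \<sqsubseteq>\<^bsub>GC p n a\<^sub>0\<^esub> y \<longleftrightarrow> gc_le p n x y"
  by (simp add: GC_def)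

text \<open>Mutual reachability of distinct configurations would put \<open>a\<close> on a cycle,
  contradicting that the carrier holds only non-dual ones.\<close>

lemma gc_le_antisym:
  assumes "gc_le p n x y" "gc_le p n y x" "x \<in> carrier (GC p n a\<^sub>0)"
  shows "x = y"
proof (cases x)
  case Bot
  then show ?thesis using assms by (cases y) auto
next
  case (Conf a)
  then obtain b where b: "y = Conf b" using assms by (cases y) auto
  have "(a, b) \<in> (game_graph p n)\<^sup>*" "(b, a) \<in> (game_graph p n)\<^sup>*" "(a, a) \<notin> (game_graph p n)\<^sup>+"
    using assms b Conf by (auto simp: reachable_def dual_def carrier_Conf)
  then have "a = b" by (metis rtranclD trancl_rtrancl_trancl)
  then show ?thesis using b Conf by simp
qed

lemma gc_le_trans: "gc_le p n x y \<Longrightarrow> gc_le p n y z \<Longrightarrow> gc_le p n x z"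
  by (cases x; cases y; cases z) (auto simp: reachable_def)

lemma partial_order_GC: "partial_order (GC p n a\<^sub>0)"
proof
  fix x show "x \<sqsubseteq>\<^bsub>GC p n a\<^sub>0\<^esub> x" by (cases x) (auto simp: reachable_def)
next
  fix x y
  assume "x \<sqsubseteq>\<^bsub>GC p n a\<^sub>0\<^esub> y" "y \<sqsubseteq>\<^bsub>GC p n a\<^sub>0\<^esub> x" "x \<in> carrier (GC p n a\<^sub>0)"
  then show "x .=\<^bsub>GC p n a\<^sub>0\<^esub> y" using gc_le_antisym by (fastforce simp: GC_def)
next
  fix x y z
  assume "x \<sqsubseteq>\<^bsub>GC p n a\<^sub>0\<^esub> y" "y \<sqsubseteq>\<^bsub>GC p n a\<^sub>0\<^esub> z"
  then show "x \<sqsubseteq>\<^bsub>GC p n a\<^sub>0\<^esub> z" using gc_le_trans by simp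
qed (auto simp: GC_def)

lemma finite_carrier_GC:
  assumes "configuration p n a\<^sub>0"
  shows "finite (carrier (GC p n a\<^sub>0))"
proof (rule finite_subset)
  show "carrier (GC p n a\<^sub>0) \<subseteq> insert Bot (Conf ` {a. configuration p n a})"
    using reachable_configuration assms by (fastforce simp: GC_def split: if_splits)
qed (simp add: finite_configurations)

section \<open>Greatest lower bounds\<close>

lemma is_glb_Bot:
  assumes "Bot \<in> carrier (GC p n a\<^sub>0)" "Bot \<in> A" "A \<subseteq> carrier (GC p n a\<^sub>0)"
  shows "is_glb (GC p n a\<^sub>0) Bot A"
  using assms by (auto simp: greatest_def Lower_def)

text \<open>The exchange property makes \<open>c\<close> reachable from both \<open>a\<close> and
  \<open>b\<close>. Conversely, a non-dual \<open>e\<close> below both has a single shot vector,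
  which dominates those of \<open>a\<close> and \<open>b\<close> and hence their maximum, so
  \<open>c\<close> reaches \<open>e\<close>.\<close>

lemma is_glb_Conf:
  assumes "p > 0" "configuration p n a\<^sub>0"
    and u: "move_seq p a\<^sub>0 u a" "\<not> dual p n a" and w: "move_seq p a\<^sub>0 w b" "\<not> dual p n b"
    and c: "c = fire p a\<^sub>0 (\<lambda>i. max (shots u i) (shots w i))"
  shows "\<exists>v. move_seq p a\<^sub>0 v c \<and> (\<forall>i. count_list v i = max (count_list u i) (count_list w i))"
    and "is_glb (GC p n a\<^sub>0) (if dual p n c then Bot else Conf c) {Conf a, Conf b}"
proof -
  have len: "length a\<^sub>0 = p" using assms by (simp add: configuration_def)
  have cf: "configuration p n a" "configuration p n b"
    using assms move_seq_configuration by blast+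
  obtain x where x: "move_seq p a x c" "\<And>i. count_list x i = count_list w i - count_list u i"
    using move_seq_join [OF len u(1) w(1)] c by blast
  obtain y where y: "move_seq p b y c"
    using move_seq_join [OF len w(1) u(1)] c by (auto simp: max.commute)
  define v where "v = u @ x"
  have v: "move_seq p a\<^sub>0 v c" "\<And>i. count_list v i = max (count_list u i) (count_list w i)"
    using move_seq_append [OF u(1) x(1)] x(2) by (auto simp: v_def)
  then show "\<exists>v. move_seq p a\<^sub>0 v c \<and> (\<forall>i. count_list v i = max (count_list u i) (count_list w i))"
    by blast
  have cc: "configuration p n c" using move_seq_configuration v(1) assms(2) by blast
  have ca: "Conf a \<in> carrier (GC p n a\<^sub>0)" "Conf b \<in> carrier (GC p n a\<^sub>0)"
    using assms move_seq_reachable by (auto simp: carrier_Conf)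
  have low: "reachable p n c e"
    if e: "\<not> dual p n e" and ae: "reachable p n a e" and be: "reachable p n b e" for e
  proof -
    obtain r where r: "move_seq p a r e" using ae reachable_move_seq by blast
    obtain s where s: "move_seq p b s e" using be reachable_move_seq by blast
    have ue: "move_seq p a\<^sub>0 (u @ r) e" and we: "move_seq p a\<^sub>0 (w @ s) e"
      using r s u w move_seq_append by blast+
    \<comment> \<open>The routes to \<open>e\<close> through \<open>a\<close> and through
      \<open>b\<close> have the same shots; this is where \<open>e\<close> being non-dual
      enters.\<close>
    have eq: "count_list (u @ r) = count_list (w @ s)"
      by (rule shots_unique [OF assms(2) ue we e])
    have "count_list v i \<le> count_list (u @ r) i" for i
      using fun_cong [OF eq, of i] v(2) [of i] by simp
    then show ?thesis using move_seq_le [OF len v(1) ue] move_seq_reachable cc by blast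
  qed
  have "reachable p n a c" "reachable p n b c" "reachable p n a\<^sub>0 c"
    using x(1) y v(1) cf assms(2) move_seq_reachable by blast+
  note rc = this
  show "is_glb (GC p n a\<^sub>0) (if dual p n c then Bot else Conf c) {Conf a, Conf b}"
  proof (cases "dual p n c")
    case True
    \<comment> \<open>A non-dual lower bound would be reachable from the dual \<open>c\<close> and
      so be dual itself; only \<open>Bot\<close> remains.\<close>
    have "gc_le p n z Bot"
      if "z \<in> carrier (GC p n a\<^sub>0)" "gc_le p n z (Conf a)" "gc_le p n z (Conf b)" for z
    proof (cases z)
      case (Conf e)
      then have "dual p n e" using that low [of e] dual_reachable [OF cc _ True] by (auto simp: carrier_Conf)
      then show ?thesis using that Conf by (simp add: carrier_Conf)
    qed simp
    then show ?thesis
      using True dual_not_dvd [OF assms(1) cc] ca by (auto simp: greatest_def Lower_def carrier_Bot)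
  next
    case False
    have "gc_le p n z (Conf c)"
      if "z \<in> carrier (GC p n a\<^sub>0)" "gc_le p n z (Conf a)" "gc_le p n z (Conf b)" for z
      using that low by (cases z) (auto simp: carrier_Conf)
    then show ?thesis
      using False rc ca by (auto simp: greatest_def Lower_def carrier_Conf)
  qed
qed

lemma lower_semilattice_GC:
  assumes "p > 0" "configuration p n a\<^sub>0"
  shows "lower_semilattice (GC p n a\<^sub>0)"
proof -
  interpret partial_order "GC p n a\<^sub>0" by (rule partial_order_GC)
  show ?thesis
  proof
    fix x y assume xy: "x \<in> carrier (GC p n a\<^sub>0)" "y \<in> carrier (GC p n a\<^sub>0)"
    show "\<exists>s. is_glb (GC p n a\<^sub>0) s {x, y}"
    proof (cases "x = Bot \<or> y = Bot")
      case True
      then show ?thesis using xy is_glb_Bot [of p n a\<^sub>0 "{x, y}"] by auto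
    next
      case False
      then obtain a b where ab: "x = Conf a" "y = Conf b" by (metis gc_elem.exhaust)
      have nd: "\<not> dual p n a" "\<not> dual p n b" using xy ab by (auto simp: carrier_Conf)
      obtain u where u: "move_seq p a\<^sub>0 u a"
        using xy(1) reachable_move_seq unfolding ab carrier_Conf by blast
      obtain w where w: "move_seq p a\<^sub>0 w b"
        using xy(2) reachable_move_seq unfolding ab carrier_Conf by blast
      show ?thesis using is_glb_Conf(2) [OF assms u nd(1) w nd(2) HOL.refl] ab by blast
    qed
  qed
qed

section \<open>Least upper bounds and the lattice property\<close>

text \<open>The join of \<open>x\<close> and \<open>y\<close> is the meet of their upper bounds, a
  finite set that is nonempty thanks to the greatest element \<open>t\<close>.\<close>

lemma lattice_if_finite_lower_semilattice:
  assumes "lower_semilattice L" "finite (carrier L)"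
    and top: "t \<in> carrier L" "\<And>x. x \<in> carrier L \<Longrightarrow> x \<sqsubseteq>\<^bsub>L\<^esub> t"
  shows "lattice L"
proof -
  interpret lower_semilattice L by fact
  have "\<exists>s. is_lub L s {x, y}" if xy: "x \<in> carrier L" "y \<in> carrier L" for x y
  proof -
    let ?U = "Upper L {x, y}"
    have "t \<in> ?U" using top xy by (auto simp: Upper_def)
    moreover have "?U \<subseteq> carrier L" by simp
    ultimately have U: "?U \<subseteq> carrier L" "finite ?U" "?U \<noteq> {}"
      using assms(2) finite_subset by auto
    then have g: "greatest L (\<Sqinter>\<^bsub>L\<^esub>?U) (Lower L ?U)" by (intro finite_inf_greatest)
    have "x \<in> Lower L ?U" "y \<in> Lower L ?U" using xy by (auto simp: Lower_def Upper_def)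
    then have "is_lub L (\<Sqinter>\<^bsub>L\<^esub>?U) {x, y}"
      using g xy U(1) by (auto simp: greatest_def least_def Upper_def Lower_def)
    then show ?thesis by blast
  qed
  then show ?thesis by unfold_locales auto
qed

lemma lattice_GC:
  assumes "p > 0" "configuration p n a\<^sub>0"
  shows "lattice (GC p n a\<^sub>0)"
proof -
  have "\<exists>t \<in> carrier (GC p n a\<^sub>0). \<forall>x \<in> carrier (GC p n a\<^sub>0). gc_le p n x t"
  proof (cases "dual p n a\<^sub>0")
    case True
    \<comment> \<open>From a dual start only dual configurations are reachable, so the order
      collapses to the single element \<open>Bot\<close>; otherwise the start itself is the greatest
      element.\<close>
    then have "x = Bot" if "x \<in> carrier (GC p n a\<^sub>0)" for x
      using that dual_reachable [OF assms(2)] by (cases x) (auto simp: carrier_Conf)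
    moreover have "Bot \<in> carrier (GC p n a\<^sub>0)"
      using dual_not_dvd [OF assms True] by (simp add: carrier_Bot)
    ultimately show ?thesis by (metis gc_le.simps(1))
  next
    case False
    then have "Conf a\<^sub>0 \<in> carrier (GC p n a\<^sub>0)" by (simp add: carrier_Conf reachable_def)
    moreover have "gc_le p n x (Conf a\<^sub>0)" if "x \<in> carrier (GC p n a\<^sub>0)" for x
      using that by (cases x) (auto simp: carrier_Conf)
    ultimately show ?thesis by blast
  qed
  then obtain t where "t \<in> carrier (GC p n a\<^sub>0)" "\<forall>x \<in> carrier (GC p n a\<^sub>0). gc_le p n x t"
    by blast
  then show ?thesis
    using lattice_if_finite_lower_semilattice [OF lower_semilattice_GC [OF assms] finite_carrier_GC [OF assms(2)], of t]
    by simp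
qed

theorem theorem4:
  fixes p n k q :: nat and a\<^sub>0 :: "int list"
  assumes "q < p" and "n = k * p + q" and "configuration p n a\<^sub>0"
  shows "lattice (GC p n a\<^sub>0) \<and>
    (\<forall>a b. Conf a \<in> carrier (GC p n a\<^sub>0) \<longrightarrow> Conf b \<in> carrier (GC p n a\<^sub>0) \<longrightarrow>
      (let m = map (\<lambda>i. max (shot p a\<^sub>0 a ! i) (shot p a\<^sub>0 b ! i)) [0..<p];
           c = map (\<lambda>i. a\<^sub>0 ! i - m ! i + m ! left p i) [0..<p]
       in configuration p n c \<and>
          (\<exists>is. move_seq p a\<^sub>0 is c \<and> shot_vector p is = m) \<and>
          is_glb (GC p n a\<^sub>0) (if dual p n c then Bot else Conf c) {Conf a, Conf b}))"
proof -
  have p: "p > 0" using assms(1) by simp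
  have "configuration p n c \<and> (\<exists>is. move_seq p a\<^sub>0 is c \<and> shot_vector p is = m) \<and>
      is_glb (GC p n a\<^sub>0) (if dual p n c then Bot else Conf c) {Conf a, Conf b}"
    if ca: "Conf a \<in> carrier (GC p n a\<^sub>0)" "Conf b \<in> carrier (GC p n a\<^sub>0)"
      and m: "m = map (\<lambda>i. max (shot p a\<^sub>0 a ! i) (shot p a\<^sub>0 b ! i)) [0..<p]"
      and c: "c = map (\<lambda>i. a\<^sub>0 ! i - m ! i + m ! left p i) [0..<p]" for a b m c
  proof -
    obtain u where u: "move_seq p a\<^sub>0 u a" "\<not> dual p n a"
      using ca(1) reachable_move_seq unfolding carrier_Conf by blast
    obtain w where w: "move_seq p a\<^sub>0 w b" "\<not> dual p n b"
      using ca(2) reachable_move_seq unfolding carrier_Conf by blast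
    note uw = u w
    \<comment> \<open>Both shot vectors are computed from the chosen sequences \<open>u\<close> and
      \<open>w\<close>, so that \<open>c\<close> takes the form required by
      \<open>is_glb_Conf\<close>.\<close>
    have m': "m = map (\<lambda>i. max (shots u i) (shots w i)) [0..<p]"
      using shot_eq [OF assms(3)] uw by (simp add: m shot_vector_def)
    have c': "c = fire p a\<^sub>0 (\<lambda>i. max (shots u i) (shots w i))"
      by (simp add: c m' fire_def left_less)
    note glb = is_glb_Conf [OF p assms(3) uw c']
    obtain v where v: "move_seq p a\<^sub>0 v c"
      "\<And>i. count_list v i = max (count_list u i) (count_list w i)"
      using glb(1) by blast
    have "shot_vector p v = m" by (simp add: m' shot_vector_def v(2) of_nat_max)
    then show ?thesis using v(1) glb(2) move_seq_configuration assms(3) by blast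
  qed
  then show ?thesis using lattice_GC [OF p assms(3)] by (simp add: Let_def)
qed

end
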